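(* Let $\mathcal{A}=\{0=a_0<a_1<\cdots<a_z\}$ be a finite set of nonnegative integers containing $0$, and assume that some $a_i\in\mathcal{A}$ is odd. For a positive integer $m$ and an integer $r\ge 0$ define $$s_{\mathcal{A}}(r,m)=\sum_{n=m2^r}^{m2^{r+1}-1} f_{\mathcal{A}}(n),$$ where $f_{\mathcal{A}}(n)$ is the number of representations $n=\sum_{i=0}^{\infty}\epsilon_i 2^i$ with all $\epsilon_i\in\mathcal{A}$. Then for every fixed positive integer $m$ there exists a rational constant $c(\mathcal{A},m)\in\mathbb{Q}$ such that $$\lim_{r\to\infty}\frac{s_{\mathcal{A}}(r,m)}{|\mathcal{A}|^r}=c(\mathcal{A},m),$$ and thus $s_{\mathcal{A}}(r,m)=c(\mathcal{A},m)\,|\mathcal{A}|^r(1+o(1))$ as $r\to\infty$.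
   Context: For a finite set $\mathcal{A}$ of nonnegative integers with $0\in\mathcal{A}$ and an integer $n\ge 0$, $f_{\mathcal{A}}(n)$ denotes the number of sequences $(\epsilon_i)_{i\ge 0}$ with $\epsilon_i\in\mathcal{A}$ for all $i$, only finitely many $\epsilon_i$ nonzero, and $\sum_{i\ge 0}\epsilon_i 2^i=n$. $|\mathcal{A}|$ denotes the number of elements of $\mathcal{A}$. *)

theory Defs
  imports Complex_Main "HOL-Library.Landau_Symbols"
begin

definition representations :: "nat set \<Rightarrow> nat \<Rightarrow> (nat \<Rightarrow> nat) set" where
  "representations A n =
     {e. (\<forall>i. e i \<in> A) \<and> finite {i. e i \<noteq> 0} \<and> (\<Sum>i | e i \<noteq> 0. e i * 2 ^ i) = n}"

definition num_representations :: "nat set \<Rightarrow> nat \<Rightarrow> nat" where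
  "num_representations A n = card (representations A n)"

definition block_sum :: "nat set \<Rightarrow> nat \<Rightarrow> nat \<Rightarrow> nat" where
  "block_sum A r m = (\<Sum>n = m * 2 ^ r..m * 2 ^ (r + 1) - 1. num_representations A n)"

text \<open>The cardinality in \<^const>\<open>num_representations\<close> is a genuine count: the set
  of representations of each number is finite.\<close>

lemma finite_representations: "finite (representations A n)"
proof (rule finite_subset)
  show "representations A n \<subseteq> {e. \<forall>i. (i \<in> {..n} \<longrightarrow> e i \<in> {..n}) \<and> (i \<notin> {..n} \<longrightarrow> e i = 0)}"
  proof
    fix e assume e: "e \<in> representations A n"
    have bound: "e i * 2 ^ i \<le> n" for i
    proof (cases "e i = 0")
      case False
      have "e i * 2 ^ i \<le> (\<Sum>i | e i \<noteq> 0. e i * 2 ^ i)"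
        using e False by (intro member_le_sum) (auto simp: representations_def)
      then show ?thesis using e by (simp add: representations_def)
    qed simp
    have "e i \<le> n" for i
    proof -
      have "e i * 1 \<le> e i * 2 ^ i" by (intro mult_le_mono) auto
      then show ?thesis using bound[of i] by linarith
    qed
    moreover have "e i = 0" if "i > n" for i
    proof (rule ccontr)
      assume "e i \<noteq> 0"
      then have "1 * 2 ^ i \<le> e i * 2 ^ i" by (intro mult_le_mono) auto
      moreover have "i < 2 ^ i" by (rule less_exp)
      ultimately show False using bound[of i] that by linarith
    qed
    ultimately show "e \<in> {e. \<forall>i. (i \<in> {..n} \<longrightarrow> e i \<in> {..n}) \<and> (i \<notin> {..n} \<longrightarrow> e i = 0)}"
      by auto
  qed
  show "finite {e. \<forall>i. (i \<in> {..n} \<longrightarrow> e i \<in> {..n}) \<and> (i \<notin> {..n} \<longrightarrow> e i = (0::nat))}"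
    by (rule finite_set_of_finite_funs) auto
qed

end

theory Submission
  imports Defs
begin

text \<open>
  Write \<open>f\<close> for \<^term>\<open>num_representations A\<close> and \<open>K\<close> for \<^term>\<open>card A\<close>.  A representation of a number
  below \<open>N * 2 ^ r\<close> splits into its \<open>r\<close> lowest digits and a representation of some \<open>k < N\<close>, so
  \<open>(\<Sum>n < N * 2 ^ r. f n) = K ^ r * (\<Sum>k < N. f k * p r (N - k))\<close>,
  where \<open>p r j\<close> is the fraction of those digit strings \<open>e\<close> in \<open>A ^ r\<close> that have
  \<open>e 0 + 2 * e 1 + \<dots> + 2 ^ (r - 1) * e (r - 1) < j * 2 ^ r\<close>
  (lemma \<open>sum_num_representations_scaled\<close>).  Removing the top digit of a string yields
  \<open>p (r + 1) j = (\<Sum>a\<in>A. p r (2 * j - a)) / K\<close>.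

  Since the digits are nonnegative, \<open>p r j\<close> decreases in \<open>r\<close>, so it has a limit \<open>v j\<close>.  This gives the
  existence of \<open>c\<close>, namely \<open>c = (K - 1) * (\<Sum>k < m. f k * v (m - k))\<close>.  It is nonzero because an odd
  digit together with \<open>0\<close> makes \<open>K \<ge> 2\<close>, because \<open>f 0\<close> is positive, and because strings whose top
  digits vanish already make \<open>v m\<close> positive.  So \<open>c\<close> can be divided by, and the limit gives the
  asymptotic formula.

  The limit is rational because \<open>v\<close> solves the equations \<open>K * v j = (\<Sum>a\<in>A. v (2 * j - a))\<close> with the
  boundary values \<open>0\<close> for \<open>j \<le> 0\<close> and \<open>1\<close> for large \<open>j\<close>.  The solution is unique by a maximum
  principle (lemma \<open>refinement_maximum_principle\<close>): the equation propagates an extreme value from \<open>j\<close>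
  to \<open>2 * j\<close>, as \<open>0 \<in> A\<close>, and hence out to where the difference of two solutions vanishes.  As the
  equations have rational coefficients, every \<open>\<rat>\<close>-linear map \<open>\<phi>\<close> from the reals to the rationals
  with \<open>\<phi> 1 = 1\<close> turns \<open>v\<close> into another solution \<open>\<phi> \<circ> v\<close>, which must be \<open>v\<close> itself.
\<close>

section \<open>Splitting off the lowest digit\<close>

lemma digit_sum_split:
  fixes e :: "nat \<Rightarrow> nat"
  assumes "finite {i. e (Suc i) \<noteq> 0}"
  shows "(\<Sum>i | e i \<noteq> 0. e i * 2 ^ i) = e 0 + 2 * (\<Sum>i | e (Suc i) \<noteq> 0. e (Suc i) * 2 ^ i)"
proof -
  let ?T = "{i. e (Suc i) \<noteq> 0}"
  have sub: "{i. e i \<noteq> 0} \<subseteq> insert 0 (Suc ` ?T)"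
  proof
    fix i assume "i \<in> {i. e i \<noteq> 0}"
    then show "i \<in> insert 0 (Suc ` ?T)" by (cases i) auto
  qed
  have "(\<Sum>i | e i \<noteq> 0. e i * 2 ^ i) = (\<Sum>i\<in>insert 0 (Suc ` ?T). e i * 2 ^ i)"
    using assms sub by (intro sum.mono_neutral_left) auto
  also have "\<dots> = e 0 + (\<Sum>i\<in>Suc ` ?T. e i * 2 ^ i)"
    using assms by (subst sum.insert) auto
  also have "(\<Sum>i\<in>Suc ` ?T. e i * 2 ^ i) = (\<Sum>i\<in>?T. e (Suc i) * 2 ^ Suc i)"
    by (subst sum.reindex) auto
  finally show ?thesis by (simp add: sum_distrib_left mult_ac)
qed

lemma finite_support_tail:
  fixes e :: "nat \<Rightarrow> nat"
  shows "finite {i. e (Suc i) \<noteq> 0} \<longleftrightarrow> finite {i. e i \<noteq> 0}"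
proof
  assume fin: "finite {i. e (Suc i) \<noteq> 0}"
  have "{i. e i \<noteq> 0} \<subseteq> insert 0 (Suc ` {i. e (Suc i) \<noteq> 0})"
  proof
    fix i assume "i \<in> {i. e i \<noteq> 0}"
    then show "i \<in> insert 0 (Suc ` {i. e (Suc i) \<noteq> 0})" by (cases i) auto
  qed
  then show "finite {i. e i \<noteq> 0}" using fin by (meson finite_imageI finite_insert finite_subset)
next
  assume "finite {i. e i \<noteq> 0}"
  then have "finite (Suc -` {i. e i \<noteq> 0})" by (intro finite_vimageI) auto
  then show "finite {i. e (Suc i) \<noteq> 0}" by (simp add: vimage_def)
qed

lemma representations_iff_tail:
  "e \<in> representations A n \<longleftrightarrow>
     e 0 \<in> A \<and> (\<exists>k. e 0 + 2 * k = n \<and> (\<lambda>i. e (Suc i)) \<in> representations A k)"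
proof -
  have "(\<forall>i. e i \<in> A) \<longleftrightarrow> e 0 \<in> A \<and> (\<forall>i. e (Suc i) \<in> A)" by (metis not0_implies_Suc)
  then show ?thesis
    unfolding representations_def using finite_support_tail[of e] digit_sum_split[of e] by auto
qed

lemma num_representations_rec:
  assumes "finite A"
  shows "num_representations A n =
    (\<Sum>p | fst p \<in> A \<and> fst p + 2 * snd p = n. num_representations A (snd p))"
proof -
  let ?P = "{p. fst p \<in> A \<and> fst p + 2 * snd p = n}"
  let ?c = "\<lambda>(p :: nat \<times> nat, e). case_nat (fst p) e :: nat \<Rightarrow> nat"
  have "?P \<subseteq> A \<times> {..n}" by auto
  then have fin: "finite ?P" using assms by (meson finite_SigmaI finite_atMost finite_subset)
  have img: "representations A n = ?c ` (SIGMA p:?P. representations A (snd p))" (is "_ = _ ` ?S")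
  proof
    show "representations A n \<subseteq> ?c ` ?S"
    proof
      fix e assume "e \<in> representations A n"
      then obtain k where "e 0 \<in> A" "e 0 + 2 * k = n" "(\<lambda>i. e (Suc i)) \<in> representations A k"
        by (auto simp: representations_iff_tail[of e])
      then have "((e 0, k), \<lambda>i. e (Suc i)) \<in> ?S" by auto
      moreover have "e = ?c ((e 0, k), \<lambda>i. e (Suc i))" by (auto split: nat.split)
      ultimately show "e \<in> ?c ` ?S" by blast
    qed
    show "?c ` ?S \<subseteq> representations A n"
      by (auto simp: representations_iff_tail[of "case_nat _ _"])
  qed
  have "inj_on ?c ?S"
  proof (rule inj_onI)
    fix x y assume xy: "x \<in> ?S" "y \<in> ?S" "?c x = ?c y"
    obtain a k e b l e' where [simp]: "x = ((a, k), e)" "y = ((b, l), e')"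
      by (metis prod.exhaust)
    have "a = b" using fun_cong[OF xy(3), of 0] by simp
    moreover have "e = e'" using fun_cong[OF xy(3), of "Suc _"] by auto
    ultimately show "x = y" using xy(1,2) by auto
  qed
  then show ?thesis
    unfolding num_representations_def img
    by (subst card_image) (use fin finite_representations in \<open>auto simp: card_SigmaI\<close>)
qed

text \<open>The weight \<open>h\<close> lets the lowest digit be split off repeatedly: it records what the digits split off
  so far demand of the remaining part \<open>n\<close> of the number.\<close>

lemma sum_num_representations_even:
  fixes h :: "nat \<Rightarrow> real"
  assumes "finite A"
  shows "(\<Sum>n<2 * N. real (num_representations A n) * h n) =
    (\<Sum>k<N. real (num_representations A k) * (\<Sum>a | a \<in> A \<and> a + 2 * k < 2 * N. h (a + 2 * k)))"
proof -
  let ?f = "\<lambda>k. real (num_representations A k)"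
  let ?T = "{p \<in> A \<times> {..<N}. fst p + 2 * snd p < 2 * N}"
  have finT: "finite ?T" using assms by simp
  have "(\<Sum>n<2 * N. ?f n * h n)
      = (\<Sum>n<2 * N. \<Sum>p | p \<in> ?T \<and> fst p + 2 * snd p = n. ?f (snd p) * h (fst p + 2 * snd p))"
  proof (rule sum.cong[OF refl])
    fix n assume n: "n \<in> {..<2 * N}"
    have eq: "{p \<in> ?T. fst p + 2 * snd p = n} = {p. fst p \<in> A \<and> fst p + 2 * snd p = n}"
      using n by auto
    show "?f n * h n = (\<Sum>p | p \<in> ?T \<and> fst p + 2 * snd p = n. ?f (snd p) * h (fst p + 2 * snd p))"
      unfolding eq num_representations_rec[OF assms, of n] by (simp add: sum_distrib_right)
  qed
  also have "\<dots> = (\<Sum>p\<in>?T. ?f (snd p) * h (fst p + 2 * snd p))"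
    by (rule sum.group[OF finT]) auto
  also have "?T = (\<lambda>(k, a). (a, k)) ` (SIGMA k:{..<N}. {a \<in> A. a + 2 * k < 2 * N})"
    by (auto simp: image_iff)
  also have "(\<Sum>p\<in>\<dots>. ?f (snd p) * h (fst p + 2 * snd p))
      = (\<Sum>(k, a)\<in>(SIGMA k:{..<N}. {a \<in> A. a + 2 * k < 2 * N}). ?f k * h (a + 2 * k))"
    by (subst sum.reindex) (auto simp: inj_on_def intro!: sum.cong)
  also have "\<dots> = (\<Sum>k<N. \<Sum>a | a \<in> A \<and> a + 2 * k < 2 * N. ?f k * h (a + 2 * k))"
    using assms by (subst sum.Sigma) auto
  finally show ?thesis by (simp add: sum_distrib_left)
qed

section \<open>The fraction of small digit strings\<close>

text \<open>The fraction of strings in \<open>A ^ r\<close> whose value, read in base two, is less than \<open>j * 2 ^ r\<close>.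
  The recursion conditions on the top digit \<open>a\<close>: the other digits must then have a value less than
  \<open>(2 * j - a) * 2 ^ r\<close>.  Taking \<open>j\<close> to be an integer avoids a case distinction on \<open>a > 2 * j\<close>.\<close>

primrec small_fraction :: "nat set \<Rightarrow> nat \<Rightarrow> int \<Rightarrow> real" where
  "small_fraction A 0 j = (if j \<ge> 1 then 1 else 0)"
| "small_fraction A (Suc r) j = (\<Sum>a\<in>A. small_fraction A r (2 * j - int a)) / real (card A)"

lemma small_fraction_nonneg: "0 \<le> small_fraction A r j"
  by (induction r arbitrary: j) (auto intro!: divide_nonneg_nonneg sum_nonneg)

lemma small_fraction_nonpos_arg: "j \<le> 0 \<Longrightarrow> small_fraction A r j = 0"
  by (induction r arbitrary: j) (auto intro!: sum.neutral)

lemma small_fraction_large_arg: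
  assumes "finite A" "A \<noteq> {}" "\<And>a. a \<in> A \<Longrightarrow> int a \<le> b" "b \<ge> 1" "j \<ge> b"
  shows "small_fraction A r j = 1"
  using \<open>j \<ge> b\<close>
proof (induction r arbitrary: j)
  case (Suc r)
  have "small_fraction A r (2 * j - int a) = 1" if "a \<in> A" for a
    using assms(3)[OF that] assms(4) Suc.prems by (intro Suc.IH) linarith
  then show ?case using assms(1,2) by (simp add: card_gt_0_iff)
qed (use assms in auto)

lemma small_fraction_Suc_le:
  assumes "finite A" "A \<noteq> {}"
  shows "small_fraction A (Suc r) j \<le> small_fraction A r j"
proof (induction r arbitrary: j)
  case 0
  have "(\<Sum>a\<in>A. small_fraction A 0 (2 * j - int a)) \<le> (\<Sum>a\<in>A. small_fraction A 0 j)"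
    by (intro sum_mono) auto
  then show ?case using assms by (simp add: field_simps card_gt_0_iff)
next
  case (Suc r)
  have "(\<Sum>a\<in>A. small_fraction A (Suc r) (2 * j - int a))
      \<le> (\<Sum>a\<in>A. small_fraction A r (2 * j - int a))"
    by (intro sum_mono Suc.IH)
  then show ?case
    by (simp only: small_fraction.simps(2)[of A "Suc r" j] small_fraction.simps(2)[of A r j]
        divide_right_mono of_nat_0_le_iff)
qed

text \<open>Keeping only the strings whose top \<open>L\<close> digits vanish, which takes \<open>j\<close> to \<open>2 ^ L * j\<close>.\<close>

lemma small_fraction_ge_scaled:
  assumes "finite A" "0 \<in> A"
  shows "small_fraction A r (2 ^ L * j) / real (card A) ^ L \<le> small_fraction A (r + L) j"
proof (induction L arbitrary: j)
  case (Suc L)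
  have "small_fraction A r (2 ^ Suc L * j) / real (card A) ^ L
      \<le> small_fraction A (r + L) (2 * j - int 0)"
    using Suc.IH[of "2 * j"] by (simp add: mult_ac)
  also have "\<dots> \<le> (\<Sum>a\<in>A. small_fraction A (r + L) (2 * j - int a))"
    using assms by (intro member_le_sum[of 0 A "\<lambda>a. small_fraction A (r + L) (2 * j - int a)"])
      (auto simp: small_fraction_nonneg)
  finally show ?case
    using divide_right_mono[of _ _ "real (card A)"] by (fastforce simp: mult_ac)
qed simp

text \<open>The induction generalizes over \<open>N\<close>, since \<open>N * 2 ^ (r + 1)\<close> is read as \<open>(2 * N) * 2 ^ r\<close>; splitting
  one digit off the \<open>n < 2 * N\<close> then produces the recursion of \<^const>\<open>small_fraction\<close>.\<close>

lemma sum_num_representations_scaled: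
  assumes "finite A" "A \<noteq> {}"
  shows "(\<Sum>n<N * 2 ^ r. real (num_representations A n)) =
    real (card A) ^ r *
      (\<Sum>k<N. real (num_representations A k) * small_fraction A r (int N - int k))"
proof (induction r arbitrary: N)
  case 0
  show ?case by (auto intro!: sum.cong)
next
  case (Suc r)
  have K: "real (card A) \<noteq> 0" using assms by auto
  have inner: "(\<Sum>a | a \<in> A \<and> a + 2 * k < 2 * N. small_fraction A r (int (2 * N) - int (a + 2 * k)))
      = real (card A) * small_fraction A (Suc r) (int N - int k)" for k
  proof -
    have "(\<Sum>a | a \<in> A \<and> a + 2 * k < 2 * N. small_fraction A r (int (2 * N) - int (a + 2 * k)))
        = (\<Sum>a\<in>A. small_fraction A r (int (2 * N) - int (a + 2 * k)))"
      using assms by (intro sum.mono_neutral_left) (auto intro!: small_fraction_nonpos_arg)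
    also have "\<dots> = (\<Sum>a\<in>A. small_fraction A r (2 * (int N - int k) - int a))"
      by (intro sum.cong refl arg_cong[of _ _ "small_fraction A r"]) simp
    finally show ?thesis using K by simp
  qed
  have "(\<Sum>n<N * 2 ^ Suc r. real (num_representations A n))
      = (\<Sum>n<(2 * N) * 2 ^ r. real (num_representations A n))" by (simp add: mult_ac)
  also have "\<dots> = real (card A) ^ r * (\<Sum>n<2 * N. real (num_representations A n)
      * small_fraction A r (int (2 * N) - int n))"
    by (rule Suc.IH)
  also have "\<dots> = real (card A) ^ r * (\<Sum>k<N. real (num_representations A k)
      * (real (card A) * small_fraction A (Suc r) (int N - int k)))"
    by (simp only: sum_num_representations_even[OF assms(1)] inner)
  finally show ?case by (simp add: sum_distrib_left mult_ac)
qed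

section \<open>Rationality of the limit\<close>

text \<open>At the largest \<open>j\<close> where \<open>\<bar>w j\<bar>\<close> attains its maximum, averaging would force the same value at
  \<open>2 * j > j\<close>, because \<open>0\<close> is one of the digits.\<close>

lemma refinement_maximum_principle:
  fixes w :: "int \<Rightarrow> real"
  assumes "finite A" "0 \<in> A"
    and rec: "\<And>j. real (card A) * w j = (\<Sum>a\<in>A. w (2 * j - int a))"
    and low: "\<And>j. j \<le> 0 \<Longrightarrow> w j = 0"
    and high: "\<And>j. j \<ge> b \<Longrightarrow> w j = 0"
  shows "w j = 0"
proof (rule ccontr)
  assume j: "w j \<noteq> 0"
  define S where "S = {j. w j \<noteq> 0}"
  have "S \<subseteq> {0..b}"
  proof
    fix i assume "i \<in> S"
    then have "\<not> i \<le> 0" "\<not> i \<ge> b" using low[of i] high[of i] by (auto simp: S_def)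
    then show "i \<in> {0..b}" by simp
  qed
  then have finS: "finite S" by (rule finite_subset) simp
  have "j \<in> S" using j by (simp add: S_def)
  define M where "M = Max ((\<lambda>j. \<bar>w j\<bar>) ` S)"
  have le_on: "\<bar>w i\<bar> \<le> M" if "i \<in> S" for i unfolding M_def using finS that by simp
  have "M > 0" using le_on[OF \<open>j \<in> S\<close>] j by simp
  then have le: "\<bar>w i\<bar> \<le> M" for i using le_on[of i] by (cases "i \<in> S") (auto simp: S_def)
  define T where "T = {i \<in> S. \<bar>w i\<bar> = M}"
  have "M \<in> (\<lambda>j. \<bar>w j\<bar>) ` S" unfolding M_def using finS \<open>j \<in> S\<close> by (intro Max_in) auto
  then have T: "finite T" "T \<noteq> {}" using finS by (auto simp: T_def)
  define i where "i = Max T"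
  have "i \<in> T" unfolding i_def using T by simp
  then have i: "\<bar>w i\<bar> = M" "i > 0" using low \<open>M > 0\<close> by (auto simp: T_def S_def not_le[symmetric])
  have "real (card A) * M = \<bar>\<Sum>a\<in>A. w (2 * i - int a)\<bar>"
    using i(1) rec[of i] by (metis abs_mult abs_of_nat)
  also have "\<dots> \<le> (\<Sum>a\<in>A. \<bar>w (2 * i - int a)\<bar>)" by (rule sum_abs)
  also have "\<dots> = \<bar>w (2 * i)\<bar> + (\<Sum>a\<in>A - {0}. \<bar>w (2 * i - int a)\<bar>)"
    using assms by (subst sum.remove[of A 0]) auto
  also have "\<dots> \<le> \<bar>w (2 * i)\<bar> + (\<Sum>a\<in>A - {0}. M)" by (intro add_left_mono sum_mono le)
  also have "\<dots> = \<bar>w (2 * i)\<bar> + (real (card A) * M - M)"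
    using sum.remove[OF assms(1,2), of "\<lambda>_. M"] by simp
  finally have "\<bar>w (2 * i)\<bar> = M" using le[of "2 * i"] by linarith
  then have "2 * i \<in> T" using \<open>M > 0\<close> by (auto simp: T_def S_def)
  then have "2 * i \<le> i" unfolding i_def using T by simp
  then show False using i(2) by simp
qed

text \<open>The first coordinate with respect to a basis of the reals over the rationals that contains \<open>1\<close>.\<close>

lemma rational_linear_retraction_exists:
  obtains \<phi> :: "real \<Rightarrow> rat"
  where "\<And>x y. \<phi> (x + y) = \<phi> x + \<phi> y" "\<And>q x. \<phi> (of_rat q * x) = q * \<phi> x" "\<phi> 1 = 1"
proof -
  interpret vector_space_pair "\<lambda>(q::rat) (x::real). of_rat q * x" "(*) :: rat \<Rightarrow> rat \<Rightarrow> rat"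
    by unfold_locales (auto simp: algebra_simps of_rat_add of_rat_mult)
  have "vs1.independent {1}" by simp
  from linear_independent_extend[OF this, of "\<lambda>_. 1"]
  obtain \<phi> where "Vector_Spaces.linear (\<lambda>(q::rat) (x::real). of_rat q * x) (*) \<phi>" "\<phi> 1 = 1"
    by auto
  then have "module_hom (\<lambda>(q::rat) (x::real). of_rat q * x) (*) \<phi>"
    by (simp add: linear_iff_module_hom)
  from module_hom.add[OF this] module_hom.scale[OF this] \<open>\<phi> 1 = 1\<close> show ?thesis
    by (rule that)
qed

text \<open>A rational linear system with a unique real solution has a rational solution; instead of
  elimination, the solution is compared with its image under a rational retraction.\<close>

lemma refinement_solution_rational:
  fixes v :: "int \<Rightarrow> real"
  assumes "finite A" "0 \<in> A"
    and rec: "\<And>j. real (card A) * v j = (\<Sum>a\<in>A. v (2 * j - int a))"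
    and low: "\<And>j. j \<le> 0 \<Longrightarrow> v j = 0"
    and high: "\<And>j. j \<ge> b \<Longrightarrow> v j = 1"
  shows "v j \<in> \<rat>"
proof -
  obtain \<phi> :: "real \<Rightarrow> rat" where \<phi>: "\<And>x y. \<phi> (x + y) = \<phi> x + \<phi> y"
      "\<And>q x. \<phi> (of_rat q * x) = q * \<phi> x" "\<phi> 1 = 1"
    using rational_linear_retraction_exists by blast
  have \<phi>0: "\<phi> 0 = 0" using \<phi>(1)[of 0 0] by simp
  have \<phi>_sum: "\<phi> (sum g B) = (\<Sum>a\<in>B. \<phi> (g a))" if "finite B" for g and B :: "nat set"
    using that by (induction B rule: finite_induct) (auto simp: \<phi> \<phi>0)
  define w where "w = (\<lambda>j. v j - of_rat (\<phi> (v j)))"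
  have "w j = 0"
  proof (rule refinement_maximum_principle[OF assms(1,2)])
    fix j
    have "of_nat (card A) * \<phi> (v j) = \<phi> (of_rat (of_nat (card A)) * v j)" by (simp only: \<phi>(2))
    also have "\<dots> = (\<Sum>a\<in>A. \<phi> (v (2 * j - int a)))" by (simp add: rec \<phi>_sum[OF assms(1)])
    finally have "real_of_rat (of_nat (card A) * \<phi> (v j))
        = real_of_rat (\<Sum>a\<in>A. \<phi> (v (2 * j - int a)))" by simp
    then show "real (card A) * w j = (\<Sum>a\<in>A. w (2 * j - int a))"
      by (simp add: w_def sum_subtractf right_diff_distrib rec of_rat_mult of_rat_sum)
  next
    fix j :: int assume "j \<le> 0"
    then show "w j = 0" by (simp add: w_def low \<phi>0)
  next
    fix j assume "j \<ge> b"
    then show "w j = 0" by (simp add: w_def high \<phi>(3))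
  qed
  then have "v j = of_rat (\<phi> (v j))" by (simp add: w_def)
  then show ?thesis by (metis Rats_of_rat)
qed

lemma small_fraction_limit:
  assumes "finite A" "0 \<in> A"
  obtains v where "\<And>j. (\<lambda>r. small_fraction A r j) \<longlonglongrightarrow> v j" "\<And>j. v j \<in> \<rat>"
    "\<And>j. v j \<ge> 0" "\<And>j. j \<ge> 1 \<Longrightarrow> v j > 0"
proof -
  have ne: "A \<noteq> {}" and K: "real (card A) > 0" using assms by (auto simp: card_gt_0_iff)
  define b where "b = int (Max A) + 1"
  have b: "b \<ge> 1" "\<And>a. a \<in> A \<Longrightarrow> int a \<le> b"
    using Max_ge[OF assms(1)] by (simp_all add: b_def le_SucI add_increasing2)
  have "\<exists>l. (\<lambda>r. small_fraction A r j) \<longlonglongrightarrow> l" for j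
  proof -
    have "decseq (\<lambda>r. small_fraction A r j)"
      using small_fraction_Suc_le[OF assms(1) ne] by (intro decseq_SucI)
    moreover have "\<forall>r. 0 \<le> small_fraction A r j" by (simp add: small_fraction_nonneg)
    ultimately obtain l where "(\<lambda>r. small_fraction A r j) \<longlonglongrightarrow> l" by (rule decseq_convergent)
    then show ?thesis ..
  qed
  then obtain v where v: "\<And>j. (\<lambda>r. small_fraction A r j) \<longlonglongrightarrow> v j" by metis
  have low: "v j = 0" if "j \<le> 0" for j
    using v[of j] small_fraction_nonpos_arg[OF that] by (simp add: LIMSEQ_const_iff)
  have high: "v j = 1" if "j \<ge> b" for j
    using v[of j] small_fraction_large_arg[OF assms(1) ne b(2,1) that] by (simp add: LIMSEQ_const_iff)
  have rec: "real (card A) * v j = (\<Sum>a\<in>A. v (2 * j - int a))" for j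
  proof (rule LIMSEQ_unique)
    show "(\<lambda>r. real (card A) * small_fraction A (Suc r) j) \<longlonglongrightarrow> real (card A) * v j"
      by (intro tendsto_mult_left LIMSEQ_Suc v)
    have "(\<lambda>r. \<Sum>a\<in>A. small_fraction A r (2 * j - int a)) \<longlonglongrightarrow> (\<Sum>a\<in>A. v (2 * j - int a))"
      by (intro tendsto_sum v)
    then show "(\<lambda>r. real (card A) * small_fraction A (Suc r) j) \<longlonglongrightarrow> (\<Sum>a\<in>A. v (2 * j - int a))"
      using K by simp
  qed
  have "v j > 0" if "j \<ge> 1" for j
  proof -
    \<comment> \<open>Once \<open>L\<close> top digits vanish, the threshold \<open>2 ^ L * j\<close> exceeds all digits, so every string counts.\<close>
    define L where "L = nat b"
    have "b \<le> 2 ^ L" using b(1) less_exp[of L] unfolding L_def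
      by (metis less_imp_le nat_le_iff of_nat_numeral of_nat_power)
    also have "\<dots> \<le> 2 ^ L * j" using that by (simp add: mult_le_cancel_left1)
    finally have "1 / real (card A) ^ L \<le> small_fraction A (r + L) j" for r
      using small_fraction_ge_scaled[OF assms, of r L j]
        small_fraction_large_arg[OF assms(1) ne b(2,1), of "2 ^ L * j" r] by simp
    then have "1 / real (card A) ^ L \<le> v j"
      by (intro LIMSEQ_le_const[OF LIMSEQ_ignore_initial_segment[OF v, of L]]) auto
    moreover have "0 < 1 / real (card A) ^ L" using K by simp
    ultimately show ?thesis by linarith
  qed
  moreover have "v j \<ge> 0" for j
    by (rule LIMSEQ_le_const[OF v]) (auto simp: small_fraction_nonneg)
  ultimately show ?thesis
    using that[of v] v refinement_solution_rational[OF assms rec low high] by blast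
qed

section \<open>Asymptotics of the block sums\<close>

lemma num_representations_0_pos:
  assumes "0 \<in> A"
  shows "num_representations A 0 > 0"
proof -
  have "(\<lambda>_. 0) \<in> representations A 0" using assms by (simp add: representations_def)
  then show ?thesis
    unfolding num_representations_def by (auto simp: card_gt_0_iff finite_representations)
qed

lemma block_sum_eq_diff:
  assumes "m > 0"
  shows "real (block_sum A r m) = (\<Sum>n<m * 2 ^ Suc r. real (num_representations A n))
    - (\<Sum>n<m * 2 ^ r. real (num_representations A n))"
proof -
  have "{k..l - 1} = {..<l} - {..<k}" if "l > 0" for k l :: nat using that by auto
  from this[of "m * 2 ^ Suc r" "m * 2 ^ r"]
  have "{m * 2 ^ r..m * 2 ^ (r + 1) - 1} = {..<m * 2 ^ Suc r} - {..<m * 2 ^ r}"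
    using assms by simp
  moreover have "{..<m * 2 ^ r} \<subseteq> {..<m * 2 ^ Suc r}" by auto
  ultimately show ?thesis
    unfolding block_sum_def of_nat_sum by (simp only: sum_diff finite_lessThan)
qed

theorem theorem2p2:
  fixes A :: "nat set" and m :: nat
  assumes "finite A" and "0 \<in> A" and "\<exists>a\<in>A. odd a" and "m > 0"
  shows "\<exists>c::real. c \<in> \<rat> \<and>
    (\<lambda>r. real (block_sum A r m) / real (card A) ^ r) \<longlonglongrightarrow> c \<and>
    (\<exists>\<epsilon> :: nat \<Rightarrow> real. \<epsilon> \<in> o(\<lambda>_. 1) \<and>
       (\<forall>r. real (block_sum A r m) = c * real (card A) ^ r * (1 + \<epsilon> r)))"
proof -
  define K where "K = real (card A)"
  have ne: "A \<noteq> {}" using assms by auto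
  obtain a where a: "a \<in> A" "odd a" using assms(3) by blast
  have "card {0, a} \<le> card A" using assms a by (intro card_mono) auto
  moreover have "a \<noteq> 0" using a by (metis even_zero)
  ultimately have K: "K > 1" by (simp add: K_def)
  obtain v where v: "\<And>j. (\<lambda>r. small_fraction A r j) \<longlonglongrightarrow> v j" "\<And>j. v j \<in> \<rat>"
      "\<And>j. v j \<ge> 0" "\<And>j. j \<ge> 1 \<Longrightarrow> v j > 0"
    using small_fraction_limit[OF assms(1,2)] by blast
  define u where "u = (\<lambda>r. \<Sum>k<m. real (num_representations A k) * small_fraction A r (int m - int k))"
  define \<sigma> where "\<sigma> = (\<Sum>k<m. real (num_representations A k) * v (int m - int k))"
  have u: "u \<longlonglongrightarrow> \<sigma>" unfolding u_def \<sigma>_def by (intro tendsto_sum tendsto_mult_left v)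
  have quot: "real (block_sum A r m) / K ^ r = K * u (Suc r) - u r" for r
  proof -
    have "(\<Sum>n<m * 2 ^ r. real (num_representations A n)) = K ^ r * u r" for r
      unfolding K_def u_def by (rule sum_num_representations_scaled[OF assms(1) ne])
    then have "real (block_sum A r m) = K ^ Suc r * u (Suc r) - K ^ r * u r"
      by (simp only: block_sum_eq_diff[OF assms(4)])
    then show ?thesis using K by (simp add: field_simps)
  qed
  define c where "c = K * \<sigma> - \<sigma>"
  have lim: "(\<lambda>r. real (block_sum A r m) / K ^ r) \<longlonglongrightarrow> c"
    unfolding quot c_def by (intro tendsto_diff tendsto_mult_left LIMSEQ_Suc u)
  have rat: "c \<in> \<rat>"
    unfolding c_def \<sigma>_def K_def by (intro Rats_diff Rats_mult Rats_sum v(2) Rats_of_nat)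
  have "\<sigma> > 0"
  proof -
    have "0 < real (num_representations A 0) * v (int m - int 0)"
      using num_representations_0_pos[OF assms(2)] v(4)[of "int m"] assms(4) by simp
    also have "\<dots> \<le> \<sigma>"
      unfolding \<sigma>_def using assms(4) v(3)
      by (intro member_le_sum[of 0 "{..<m}"
            "\<lambda>k. real (num_representations A k) * v (int m - int k)"]) auto
    finally show ?thesis .
  qed
  then have "c > 0" using K by (simp add: c_def)
  define \<epsilon> where "\<epsilon> = (\<lambda>r. real (block_sum A r m) / K ^ r / c - 1)"
  have "\<epsilon> \<longlonglongrightarrow> c / c - 1" unfolding \<epsilon>_def using \<open>c > 0\<close> by (intro tendsto_intros lim) auto
  then have "\<epsilon> \<in> o(\<lambda>_. 1)" using \<open>c > 0\<close> by (intro smalloI_tendsto) auto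
  moreover have "real (block_sum A r m) = c * K ^ r * (1 + \<epsilon> r)" for r
    using \<open>c > 0\<close> K by (simp add: \<epsilon>_def)
  ultimately show ?thesis using rat lim unfolding K_def by blast
qed

end
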